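(* (ZFC) There are no Magidor filters; that is, for no uncountable cardinal $\lambda$ is there a Magidor filter over $\lambda$.
   Context: The ambient theory is ZFC. For a cardinal $\lambda$ and $x\subseteq\lambda$, $[x]^{\aleph_0\text{-bd}}$ denotes the collection of all subsets $u\subseteq x$ with $|u|=\aleph_0$ and $u$ bounded in $\lambda$, i.e. $\sup(u)<\lambda$ (there is no restriction on the order type of $u$). For $c:[\lambda]^{\aleph_0\text{-bd}}\rightarrow\lambda$, $c''[x]^{\aleph_0\text{-bd}}=\{c(u):u\in[x]^{\aleph_0\text{-bd}}\}$. A filter $F$ over $\lambda$ (a filter of subsets of $\lambda$) is uniform iff every element of $F$ has cardinality $\lambda$. A filter $F$ over $\lambda$ is a Magidor filter iff: (1) $F$ is uniform; (2) $F$ contains all the end-segments $\{\beta<\lambda:\beta\geq\alpha\}$ of $\lambda$, for $\alpha<\lambda$; (3) for every coloring $c:[\lambda]^{\aleph_0\text{-bd}}\rightarrow\lambda$ there exists $x\in F$ for which $c''[x]^{\aleph_0\text{-bd}}\neq\lambda$. *)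

theory Defs
  imports Main "HOL-Library.FuncSet"
begin

unbundle cardinal_syntax

text \<open>
  A cardinal is a relation \<open>r\<close> with \<open>Card_order r\<close>, that is, a
  well-order that is minimal among the well-orders of its field.  The points of the
  cardinal \<open>\<lambda>\<close> (the ordinals below it) are the elements of
  \<open>Field r\<close>, and \<open>(a, b) \<in> r\<close> reads \<open>a \<le> b\<close>.
\<close>

text \<open>
  The set $[x]^{\aleph_0\mathrm{-bd}}$.  For an infinite (hence limit) cardinal
  \<open>\<lambda>\<close>, \<open>sup u < \<lambda>\<close> holds iff some point of
  \<open>\<lambda>\<close> is a (non-strict) upper bound of \<open>u\<close>.
\<close>

definition bd_subsets :: "'a rel \<Rightarrow> 'a set \<Rightarrow> 'a set set" where
  "bd_subsets r x = {u. u \<subseteq> x \<and> |u| =o natLeq \<and> (\<exists>a\<in>Field r. u \<subseteq> under r a)}"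

text \<open>
  A filter over \<open>\<lambda>\<close> is a library filter on the ambient type that
  contains \<open>Field r\<close>.  Such filters correspond bijectively to the (possibly
  improper) filters of subsets of \<open>Field r\<close>, via the following family.
\<close>

definition filter_sets :: "'a rel \<Rightarrow> 'a filter \<Rightarrow> 'a set set" where
  "filter_sets r F = {x. x \<subseteq> Field r \<and> (\<forall>\<^sub>F a in F. a \<in> x)}"

definition filter_over :: "'a rel \<Rightarrow> 'a filter \<Rightarrow> bool" where
  "filter_over r F \<longleftrightarrow> F \<le> principal (Field r)"

definition uniform_filter :: "'a rel \<Rightarrow> 'a filter \<Rightarrow> bool" where
  "uniform_filter r F \<longleftrightarrow> (\<forall>x\<in>filter_sets r F. |x| =o r)"

text \<open>
  Only the values of a colouring \<open>c\<close> on \<open>bd_subsets r (Field r)\<close>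
  are constrained or used.
\<close>

definition Magidor_filter :: "'a rel \<Rightarrow> 'a filter \<Rightarrow> bool" where
  "Magidor_filter r F \<longleftrightarrow>
     filter_over r F \<and>
     uniform_filter r F \<and>
     (\<forall>a\<in>Field r. above r a \<in> filter_sets r F) \<and>
     (\<forall>c \<in> bd_subsets r (Field r) \<rightarrow> Field r.
        \<exists>x\<in>filter_sets r F. c ` bd_subsets r x \<noteq> Field r)"

end

theory Submission
  imports Defs "HOL-Library.Countable_Set" "HOL-Library.Diagonal_Subsequence"
begin

text \<open>
  Let \<open>F\<close> be a Magidor filter, and call a set \<open>K\<close> of colours full if one colouring attains all
  of \<open>K\<close> on every member of \<open>F\<close>.  Take a set \<open>K\<close> of least cardinality that is not full; then
  \<open>\<aleph>\<^sub>0 < |K| < \<lambda>\<close>, the upper bound because the least point of a set may select one of the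
  colourings for the initial segments of \<open>\<lambda>\<close>.  Fewer than \<open>|K|\<close> colourings can be coded into one,
  so together with \<open>\<omega>\<close>-Jonsson functions the failure of fullness yields, for any fewer than \<open>|K|\<close>
  suitable sets \<open>Y\<close> with \<open>|Y| \<ge> |K|\<close>, a single \<open>D \<in> F\<close> with \<open>|D \<inter> Y| < |Y|\<close> for all of them.
  Recursion along \<open>K\<close> gives \<open>D i \<in> F\<close> that shrink all finite intersections of their predecessors.
  Since cardinals do not decrease infinitely often, all but \<open>|K|\<close> points lie in only finitely many
  \<open>D i\<close>.  For such a point \<open>a\<close> the colours below some \<open>i\<close> with \<open>a \<in> D i\<close> form a full set; letting
  the least point select a colouring for it makes \<open>K\<close> full, because every member of \<open>F\<close> meets every
  \<open>D i\<close> in such a point.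
\<close>

section \<open>Countable sets and a universal colouring\<close>

lemma card_of_ordIso_natLeq_iff: "|u| =o natLeq \<longleftrightarrow> infinite u \<and> countable u"
proof -
  have "countable u \<longleftrightarrow> |u| \<le>o |UNIV::nat set|"
    unfolding countable_def card_of_ordLeq[symmetric] by auto
  moreover have "|u| =o natLeq \<longleftrightarrow> |u| =o |UNIV::nat set|"
    by (meson card_of_nat ordIso_symmetric ordIso_transitive)
  ultimately show ?thesis
    by (simp add: ordIso_iff_ordLeq infinite_iff_card_of_nat conj_commute)
qed

text \<open>
  For a fixed set of representatives \<open>rep\<close> modulo finite sets, deleting points of
  \<open>z \<inter> rep z\<close> from \<open>z\<close> increases the cardinality of the symmetric difference with
  \<open>rep z\<close> by one each time.
\<close>

lemma mod_finite_colouring: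
  obtains rep :: "'a set \<Rightarrow> 'a set" and t :: "'a set \<Rightarrow> nat" where
    "\<And>z. finite (sym_diff z (rep z))"
    "\<And>z w k. infinite z \<Longrightarrow> finite w \<Longrightarrow>
      \<exists>u\<subseteq>z - w. finite (z - u) \<and> rep u = rep z \<and> t u = k"
proof -
  define rep :: "'a set \<Rightarrow> 'a set" where "rep u = (SOME v. finite (sym_diff u v))" for u
  \<comment> \<open>Each \<open>k\<close> is the first component of arbitrarily large codes, so the
    difference from \<open>rep z\<close> can be enlarged until it decodes to
    \<open>k\<close>.\<close>
  define t :: "'a set \<Rightarrow> nat" where
    "t u = fst (prod_decode (card (sym_diff u (rep u))))" for u
  have fin: "finite (sym_diff u (rep u))" for u
    unfolding rep_def by (rule someI[of _ u]) simp
  \<comment> \<open>Sets at finite difference give \<open>SOME\<close> the same predicate, hence the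
    same representative.\<close>
  have eq: "rep u = rep v" if "finite (sym_diff u v)" for u v
  proof -
    have "finite (sym_diff u w) \<longleftrightarrow> finite (sym_diff v w)" for w
    proof
      assume "finite (sym_diff u w)"
      then show "finite (sym_diff v w)"
        by (rule finite_subset[rotated, OF finite_UnI[OF that]]) auto
    next
      assume "finite (sym_diff v w)"
      then show "finite (sym_diff u w)"
        by (rule finite_subset[rotated, OF finite_UnI[OF that]]) auto
    qed
    then show ?thesis unfolding rep_def by simp
  qed
  have col: "\<exists>u\<subseteq>z - w. finite (z - u) \<and> rep u = rep z \<and> t u = k"
    if "infinite z" "finite w" for z w :: "'a set" and k
  proof -
    let ?z = "z - w"
    have "finite (sym_diff ?z z)" using that by (auto intro: finite_subset[of _ w])
    then have rz: "rep ?z = rep z" by (rule eq)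
    define m where "m = card (sym_diff ?z (rep z))"
    define n where "n = prod_encode (k, m)"
    have "m \<le> n" by (simp add: n_def le_prod_encode_2)
    have fz: "finite (sym_diff ?z (rep z))" using fin[of ?z] rz by simp
    have "infinite (?z \<inter> rep z)"
    proof
      assume "finite (?z \<inter> rep z)"
      then have "finite (?z \<inter> rep z \<union> sym_diff ?z (rep z))" using fz by blast
      then have "finite ?z" by (rule finite_subset[rotated]) auto
      then show False using that by simp
    qed
    then obtain s where s: "finite s" "card s = n - m" "s \<subseteq> ?z \<inter> rep z"
      by (meson infinite_arbitrarily_large)
    let ?u = "?z - s"
    have fzu: "finite (z - ?u)"
      by (rule finite_subset[of _ "w \<union> s"]) (use that s in auto)
    have ru: "rep ?u = rep z"
      by (rule eq, rule finite_subset[of _ "w \<union> s"]) (use that s in auto)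
    have "sym_diff ?u (rep z) = sym_diff ?z (rep z) \<union> s" using s by auto
    moreover have "card (sym_diff ?z (rep z) \<union> s) = m + (n - m)"
      unfolding m_def s(2)[unfolded m_def, symmetric]
      by (rule card_Un_disjoint) (use s fz in auto)
    ultimately have "t ?u = k" using ru \<open>m \<le> n\<close> by (simp add: t_def n_def)
    then show ?thesis using fzu ru by (intro exI[of _ ?u]) auto
  qed
  show thesis by (rule that[OF fin col])
qed

section \<open>Subsets of order type \<open>\<omega>\<close>\<close>

text \<open>For a subset \<open>u\<close> of a well-order, this is the initial segment of
  \<open>u\<close> of order type at most \<omega>.\<close>

definition omega_part :: "'a rel \<Rightarrow> 'a set \<Rightarrow> 'a set" where
  "omega_part r u = {a \<in> u. finite (underS r a \<inter> u)}"

lemma omega_part_subset: "omega_part r u \<subseteq> u"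
  by (auto simp: omega_part_def)

text \<open>A least point of \<open>u\<close> outside a finite \<omega>-part would have only
  finitely many predecessors in \<open>u\<close>, and so belong to it.\<close>

lemma infinite_omega_part:
  assumes "Well_order r" "infinite u"
  shows "infinite (omega_part r u)"
proof
  assume fin: "finite (omega_part r u)"
  have "wf (r - Id)" using assms(1) by (simp add: well_order_on_def)
  moreover obtain a where "a \<in> u - omega_part r u"
    using fin assms(2) finite_subset[of u "omega_part r u"] by blast
  ultimately obtain m where m: "m \<in> u - omega_part r u"
    and min: "\<And>y. (y, m) \<in> r - Id \<Longrightarrow> y \<notin> u - omega_part r u"
    by (metis wfE_min)
  have "underS r m \<inter> u \<subseteq> omega_part r u" using min by (auto simp: underS_def)
  then have "finite (underS r m \<inter> u)" using fin finite_subset by blast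
  then show False using m by (auto simp: omega_part_def)
qed

lemma omega_part_eq_self_mono:
  assumes "omega_part r u = u" "v \<subseteq> u"
  shows "omega_part r v = v"
proof -
  have "finite (underS r a \<inter> v)" if "a \<in> v" for a
  proof -
    have "finite (underS r a \<inter> u)" using assms that by (auto simp: omega_part_def)
    then show ?thesis by (rule finite_subset[rotated]) (use assms in auto)
  qed
  then show ?thesis by (auto simp: omega_part_def)
qed

lemma omega_part_idem: "omega_part r (omega_part r u) = omega_part r u"
proof -
  have "finite (underS r a \<inter> omega_part r u)" if "a \<in> omega_part r u" for a
    by (rule finite_subset[of _ "underS r a \<inter> u"]) (use that in \<open>auto simp: omega_part_def\<close>)
  then show ?thesis by (auto simp: omega_part_def)
qed

text \<open>Points of \<open>v\<close> gain no predecessors from \<open>w\<close>, while every point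
  of \<open>w\<close> has the infinite set \<open>v\<close> below it. This allows \<open>v\<close>
  and \<open>w\<close> to be read off their union.\<close>

lemma omega_part_Un:
  assumes "antisym r" "omega_part r v = v" "infinite v"
    and below: "\<And>a b. a \<in> v \<Longrightarrow> b \<in> w \<Longrightarrow> b \<in> aboveS r a"
  shows "omega_part r (v \<union> w) = v"
proof -
  have "underS r a \<inter> (v \<union> w) = underS r a \<inter> v" if "a \<in> v" for a
    using below[OF that] assms(1) by (auto simp: underS_def aboveS_def antisym_def)
  moreover have "finite (underS r a \<inter> v)" if "a \<in> v" for a
    using that assms(2) by (auto simp: omega_part_def)
  moreover have "infinite (underS r b \<inter> (v \<union> w))" if "b \<in> w" for b
  proof -
    have "v \<subseteq> underS r b \<inter> (v \<union> w)"
      using below that by (auto simp: underS_def aboveS_def)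
    then show ?thesis using assms(3) finite_subset by blast
  qed
  ultimately show ?thesis by (auto simp: omega_part_def)
qed

section \<open>\<open>\<omega>\<close>-Jonsson functions\<close>

text \<open>On infinite sets, these are the dense open families for inclusion. They generalize the
  sets of order type \<omega> to a notion that survives transport along bijections.\<close>

definition dense_hereditary :: "'a set set \<Rightarrow> bool" where
  "dense_hereditary H \<longleftrightarrow>
     (\<forall>z. infinite z \<longrightarrow> (\<exists>v\<subseteq>z. infinite v \<and> v \<in> H)) \<and>
     (\<forall>v\<in>H. \<forall>u\<subseteq>v. infinite u \<longrightarrow> u \<in> H)"

lemma dense_hereditary_omega_part:
  assumes "Well_order r"
  shows "dense_hereditary {u. omega_part r u = u}"
  unfolding dense_hereditary_def
proof (intro conjI allI impI ballI)
  fix z :: "'a set" assume "infinite z"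
  then show "\<exists>v\<subseteq>z. infinite v \<and> v \<in> {u. omega_part r u = u}"
    by (intro exI[of _ "omega_part r z"])
      (simp add: omega_part_subset omega_part_idem infinite_omega_part[OF assms])
next
  fix v u assume "v \<in> {u. omega_part r u = u}" "u \<subseteq> v"
  then show "u \<in> {u. omega_part r u = u}" by (simp add: omega_part_eq_self_mono)
qed

lemma dense_hereditary_vimage:
  fixes p :: "'a \<Rightarrow> 'b"
  assumes H: "dense_hereditary H" and p: "inj_on p A"
  shows "dense_hereditary {u. infinite (u \<inter> A) \<longrightarrow> p ` (u \<inter> A) \<in> H}"
  unfolding dense_hereditary_def
proof (intro conjI allI impI ballI)
  fix z :: "'a set" assume z: "infinite z"
  show "\<exists>v\<subseteq>z. infinite v \<and> v \<in> {u. infinite (u \<inter> A) \<longrightarrow> p ` (u \<inter> A) \<in> H}"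
  proof (cases "infinite (z \<inter> A)")
    case True
    moreover have "inj_on p (z \<inter> A)" using p inj_on_subset by blast
    ultimately have "infinite (p ` (z \<inter> A))" using finite_image_iff by blast
    then obtain v where v: "v \<subseteq> p ` (z \<inter> A)" "infinite v" "v \<in> H"
      using H unfolding dense_hereditary_def by blast
    let ?v = "z \<inter> A \<inter> p -` v"
    have "p ` ?v = v" "?v \<inter> A = ?v" using v by auto
    then show ?thesis using v
      by (intro exI[of _ ?v]) (auto dest: finite_imageI[of ?v p])
  qed (use z in auto)
next
  fix v u
  assume *: "v \<in> {u. infinite (u \<inter> A) \<longrightarrow> p ` (u \<inter> A) \<in> H}" "u \<subseteq> v"
  have "p ` (u \<inter> A) \<in> H" if inf: "infinite (u \<inter> A)"
  proof -
    have "u \<inter> A \<subseteq> v \<inter> A" using * by auto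
    then have "infinite (v \<inter> A)" using inf finite_subset by blast
    then have "p ` (v \<inter> A) \<in> H" using * by auto
    moreover have "infinite (p ` (u \<inter> A))"
      using inf finite_image_iff[OF inj_on_subset[OF p, of "u \<inter> A"]] by simp
    moreover have "p ` (u \<inter> A) \<subseteq> p ` (v \<inter> A)" using \<open>u \<subseteq> v\<close> by auto
    ultimately show ?thesis using H unfolding dense_hereditary_def by blast
  qed
  then show "u \<in> {u. infinite (u \<inter> A) \<longrightarrow> p ` (u \<inter> A) \<in> H}" by auto
qed

text \<open>Successive thinning meets \<open>H 0\<close>, \<open>H 1\<close> and so on; the diagonal
  sequence is, up to finitely many terms, a subsequence of each stage.\<close>

lemma dense_hereditary_diagonal:
  fixes \<alpha> :: "nat \<Rightarrow> 'a" and H :: "nat \<Rightarrow> 'a set set"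
  assumes H: "\<And>n. dense_hereditary (H n)" and \<alpha>: "inj \<alpha>"
  obtains z where "z \<subseteq> range \<alpha>" "infinite z"
    "\<And>n. \<exists>w. finite w \<and> (\<forall>u\<subseteq>z - w. infinite u \<longrightarrow> u \<in> H n)"
proof -
  have inf: "infinite (range (\<lambda>i. \<alpha> (s i)))" if "strict_mono s" for s :: "nat \<Rightarrow> nat"
  proof (rule range_inj_infinite)
    show "inj (\<lambda>i. \<alpha> (s i))"
      using inj_compose[OF \<alpha> strict_mono_imp_inj_on[OF that]] by (simp add: o_def)
  qed
  have her: "u \<in> H n" if "v \<in> H n" "u \<subseteq> v" "infinite u" for u v n
    using H[of n] that unfolding dense_hereditary_def by blast
  \<comment> \<open>Speaking of all infinite subsets of the range makes the condition pass to
    further subsequences.\<close>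
  interpret subseqs "\<lambda>n s. \<forall>u\<subseteq>range (\<lambda>i. \<alpha> (s i)). infinite u \<longrightarrow> u \<in> H n"
  proof
    fix n :: nat and s :: "nat \<Rightarrow> nat"
    assume s: "strict_mono s"
    obtain v where v: "v \<subseteq> range (\<lambda>i. \<alpha> (s i))" "infinite v" "v \<in> H n"
      using H[of n] inf[OF s] unfolding dense_hereditary_def by blast
    let ?I = "{i. \<alpha> (s i) \<in> v}"
    have "v = (\<lambda>i. \<alpha> (s i)) ` ?I" using v by auto
    then have I: "infinite ?I" using v(2) by (metis finite_imageI)
    define e where "e = enumerate ?I"
    have "range (\<lambda>i. \<alpha> ((s \<circ> e) i)) \<subseteq> v"
      using enumerate_in_set[OF I] by (auto simp: e_def)
    then have "\<forall>u\<subseteq>range (\<lambda>i. \<alpha> ((s \<circ> e) i)). infinite u \<longrightarrow> u \<in> H n"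
      by (meson her[OF v(3)] order_trans)
    moreover have "strict_mono e" unfolding e_def using I by (rule strict_mono_enumerate)
    ultimately show "\<exists>r' :: nat \<Rightarrow> nat. strict_mono r' \<and>
        (\<forall>u\<subseteq>range (\<lambda>i. \<alpha> ((s \<circ> r') i)). infinite u \<longrightarrow> u \<in> H n)"
      by blast
  qed
  let ?z = "range (\<lambda>i. \<alpha> (diagseq i))"
  show thesis
  proof (rule that)
    show "?z \<subseteq> range \<alpha>" by auto
    show "infinite ?z" using inf[OF subseq_diagseq] .
    fix n
    let ?S = "range (\<lambda>i. \<alpha> ((diagseq \<circ> ((+) (Suc n))) i))"
    have S: "\<forall>u\<subseteq>?S. infinite u \<longrightarrow> u \<in> H n"
    proof (rule diagseq_holds)
      fix r s :: "nat \<Rightarrow> nat" and m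
      assume s: "\<forall>u\<subseteq>range (\<lambda>i. \<alpha> (s i)). infinite u \<longrightarrow> u \<in> H m"
      have "range (\<lambda>i. \<alpha> ((s \<circ> r) i)) \<subseteq> range (\<lambda>i. \<alpha> (s i))" by auto
      then show "\<forall>u\<subseteq>range (\<lambda>i. \<alpha> ((s \<circ> r) i)). infinite u \<longrightarrow> u \<in> H m"
        using s by (meson subset_trans)
    qed
    let ?w = "(\<lambda>i. \<alpha> (diagseq i)) ` {..n}"
    have "?z - ?w \<subseteq> ?S"
    proof
      fix a assume "a \<in> ?z - ?w"
      then obtain i where i: "a = \<alpha> (diagseq i)" "i > n" by force
      then have "a = \<alpha> ((diagseq \<circ> ((+) (Suc n))) (i - Suc n))" by simp
      then show "a \<in> ?S" by blast
    qed
    then have "\<forall>u\<subseteq>?z - ?w. infinite u \<longrightarrow> u \<in> H n" using S by (meson subset_trans)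
    then show "\<exists>w. finite w \<and> (\<forall>u\<subseteq>?z - w. infinite u \<longrightarrow> u \<in> H n)"
      by (intro exI[of _ ?w]) simp
  qed
qed

text \<open>
  The argument of Galvin and Prikry: if every set \<open>A\<close> of full size could be shrunk so as to lose
  a value in \<open>A\<close>, then the lost values along a decreasing \<open>\<omega>\<close>-sequence would form a countable
  set on which the colouring omits too much.
\<close>

lemma omega_Jonsson_subset:
  fixes Y :: "'a set"
  assumes "infinite Y"
  obtains f :: "'a set \<Rightarrow> 'a" and A where "A \<subseteq> Y" "|A| =o |Y|"
    "\<And>H B a. dense_hereditary H \<Longrightarrow> B \<subseteq> A \<Longrightarrow> |B| =o |Y| \<Longrightarrow> a \<in> A \<Longrightarrow>
      \<exists>u\<in>H. u \<subseteq> B \<and> |u| =o natLeq \<and> f u = a"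
proof -
  obtain rep :: "'a set \<Rightarrow> 'a set" and t :: "'a set \<Rightarrow> nat" where
    rep: "\<And>z. finite (sym_diff z (rep z))" and
    t: "\<And>z w k. infinite z \<Longrightarrow> finite w \<Longrightarrow>
      \<exists>u\<subseteq>z - w. finite (z - u) \<and> rep u = rep z \<and> t u = k"
    by (rule mod_finite_colouring) blast
  \<comment> \<open>As \<open>rep\<close> ignores finite changes and \<open>t\<close> can be
    adjusted at will, every point of a countable \<open>rep z\<close> is the colour of a cofinite
    subset of the infinite set \<open>z\<close>.\<close>
  define f where "f u = from_nat_into (rep u) (t u)" for u
  define good where "good A \<longleftrightarrow>
    (\<forall>H B a. dense_hereditary H \<longrightarrow> B \<subseteq> A \<longrightarrow> |B| =o |Y| \<longrightarrow> a \<in> A \<longrightarrow>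
      (\<exists>u\<in>H. u \<subseteq> B \<and> |u| =o natLeq \<and> f u = a))" for A :: "'a set"
  have "\<exists>A. A \<subseteq> Y \<and> |A| =o |Y| \<and> good A"
  proof (rule ccontr)
    assume neg: "\<not> ?thesis"
    \<comment> \<open>Here \<open>full\<close> means of the size of \<open>Y\<close>. In
      \<open>lost\<close>, the missed value \<open>a\<close> is also removed from \<open>B\<close>,
      so that the values lost along a sequence are distinct.\<close>
    define full where "full A \<longleftrightarrow> A \<subseteq> Y \<and> |A| =o |Y|" for A
    define lost where "lost A B a H \<longleftrightarrow> B \<subseteq> A \<and> a \<in> A \<and> a \<notin> B \<and> dense_hereditary H \<and>
      (\<forall>u\<in>H. u \<subseteq> B \<longrightarrow> |u| =o natLeq \<longrightarrow> f u \<noteq> a)" for A B a H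
    have step: "\<exists>B a H. full B \<and> lost A B a H" if A: "full A" for A
    proof -
      have "\<not> good A" using neg A unfolding full_def by blast
      then obtain H B a where H: "dense_hereditary H" and B: "B \<subseteq> A" "|B| =o |Y|" and a: "a \<in> A"
        and no: "\<And>u. u \<in> H \<Longrightarrow> u \<subseteq> B \<Longrightarrow> |u| =o natLeq \<Longrightarrow> f u \<noteq> a"
        unfolding good_def by blast
      have "infinite B" using B(2) assms card_of_ordIso_finite by blast
      then have "|B - {a}| =o |B|"
        by (meson card_of_ordIso infinite_imp_bij_betw ordIso_symmetric)
      then have "full (B - {a})"
        using B A ordIso_transitive unfolding full_def by blast
      moreover have "lost A (B - {a}) a H"
        unfolding lost_def using H B a no by blast
      ultimately show ?thesis by blast
    qed
    have "full Y" by (simp add: full_def card_of_refl)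
    then obtain A where A: "\<And>n. full (A n)" "\<And>n. \<exists>a H. lost (A n) (A (Suc n)) a H"
      using dependent_nat_choice[of "\<lambda>_. full" "\<lambda>_ A B. \<exists>a H. lost A B a H"] step by metis
    then obtain \<alpha> H where "\<And>n. lost (A n) (A (Suc n)) (\<alpha> n) (H n)" by metis
    then have AS: "\<And>n. A (Suc n) \<subseteq> A n" and \<alpha>A: "\<And>n. \<alpha> n \<in> A n" "\<And>n. \<alpha> n \<notin> A (Suc n)"
      and H: "\<And>n. dense_hereditary (H n)"
      and no: "\<And>n u. u \<in> H n \<Longrightarrow> u \<subseteq> A (Suc n) \<Longrightarrow> |u| =o natLeq \<Longrightarrow> f u \<noteq> \<alpha> n"
      by (auto simp: lost_def)
    have mem: "\<alpha> m \<in> A (Suc n)" if "n < m" for m n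
      using lift_Suc_antimono_le[of A "Suc n" m, OF AS] \<alpha>A(1)[of m] that by auto
    have "inj \<alpha>"
      by (rule linorder_injI) (metis mem \<alpha>A(2))
    then obtain z where z: "z \<subseteq> range \<alpha>" "infinite z"
      and zH: "\<And>n. \<exists>w. finite w \<and> (\<forall>u\<subseteq>z - w. infinite u \<longrightarrow> u \<in> H n)"
      using dense_hereditary_diagonal[of H \<alpha>, OF H] by metis
    have "z \<inter> rep z \<noteq> {}"
    proof
      assume "z \<inter> rep z = {}"
      then have "z \<subseteq> sym_diff z (rep z)" by blast
      then show False using rep[of z] z(2) finite_subset by blast
    qed
    \<comment> \<open>A point of both sets is a lost value, and one that \<open>f\<close> can be
      made to take near \<open>z\<close>.\<close>
    then obtain n where n: "\<alpha> n \<in> z" "\<alpha> n \<in> rep z" using z(1) by auto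
    obtain w where w: "finite w" "\<And>u. u \<subseteq> z - w \<Longrightarrow> infinite u \<Longrightarrow> u \<in> H n"
      using zH by metis
    have "countable z" using z(1) by (rule countable_subset) simp
    then have "countable (z \<union> sym_diff z (rep z))"
      using countable_finite[OF rep[of z]] by (rule countable_Un)
    then have "countable (rep z)" by (rule countable_subset[rotated]) blast
    then obtain k where k: "from_nat_into (rep z) k = \<alpha> n"
      using from_nat_into_surj[OF _ n(2)] by blast
    obtain u where u: "u \<subseteq> z - (w \<union> \<alpha> ` {..n})" "finite (z - u)" "rep u = rep z" "t u = k"
      using t[OF z(2), of "w \<union> \<alpha> ` {..n}" k] w(1) by auto
    have "u \<union> (z - u) = z" using u(1) by blast
    then have "infinite u" using u(2) z(2) finite_UnI[of u "z - u"] by auto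
    moreover have "countable u"
      by (rule countable_subset[OF _ \<open>countable z\<close>]) (use u(1) in blast)
    moreover have "u \<subseteq> A (Suc n)"
    proof
      fix b assume "b \<in> u"
      then obtain m where "b = \<alpha> m" "m > n" using u(1) z(1) by force
      then show "b \<in> A (Suc n)" using mem by simp
    qed
    moreover have "f u = \<alpha> n" using u k by (simp add: f_def)
    ultimately show False
      using no[of u n] w(2)[of u] u(1) by (auto simp: card_of_ordIso_natLeq_iff)
  qed
  then obtain A where A: "A \<subseteq> Y" "|A| =o |Y|" "good A" by blast
  show thesis
  proof (rule that[OF A(1,2)])
    fix H :: "'a set set" and B a
    assume "dense_hereditary H" "B \<subseteq> A" "|B| =o |Y|" "a \<in> A"
    then show "\<exists>u\<in>H. u \<subseteq> B \<and> |u| =o natLeq \<and> f u = a"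
      using A(3) unfolding good_def by simp
  qed
qed

text \<open>A bijection onto \<open>Y\<close> from the subset \<open>A\<close> of
  \<open>omega_Jonsson_subset\<close> carries the function over, with \<open>H\<close> pulled back
  to \<open>A\<close>.\<close>

lemma omega_Jonsson:
  fixes Y :: "'a set"
  assumes "infinite Y" and H: "dense_hereditary H"
  obtains g :: "'a set \<Rightarrow> 'a" where "\<And>Z y. Z \<subseteq> Y \<Longrightarrow> |Z| =o |Y| \<Longrightarrow> y \<in> Y \<Longrightarrow>
    \<exists>u\<in>H. u \<subseteq> Z \<and> |u| =o natLeq \<and> g u = y"
proof -
  obtain f :: "'a set \<Rightarrow> 'a" and A where A: "A \<subseteq> Y" "|A| =o |Y|" and
    f: "\<And>H B a. dense_hereditary H \<Longrightarrow> B \<subseteq> A \<Longrightarrow> |B| =o |Y| \<Longrightarrow> a \<in> A \<Longrightarrow>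
      \<exists>u\<in>H. u \<subseteq> B \<and> |u| =o natLeq \<and> f u = a"
    by (rule omega_Jonsson_subset[OF assms(1)]) blast
  obtain p where p: "bij_betw p A Y" using A(2) card_of_ordIso by blast
  let ?q = "the_inv_into A p"
  define g where "g u = p (f (?q ` u))" for u
  let ?H = "{u. infinite (u \<inter> A) \<longrightarrow> p ` (u \<inter> A) \<in> H}"
  have "\<exists>v\<in>H. v \<subseteq> Z \<and> |v| =o natLeq \<and> g v = y" if Z: "Z \<subseteq> Y" "|Z| =o |Y|" and y: "y \<in> Y" for Z y
  proof -
    have inj: "inj_on p A" and im: "p ` A = Y" using p by (auto simp: bij_betw_def)
    have q: "bij_betw ?q Y A" by (rule bij_betw_the_inv_into[OF p])
    then have qZ: "bij_betw ?q Z (?q ` Z)" using Z(1) by (meson bij_betw_subset subset_refl)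
    have "|?q ` Z| =o |Y|"
      using card_of_ordIsoI[OF qZ] Z(2) ordIso_symmetric ordIso_transitive by blast
    moreover have "?q ` Z \<subseteq> A" using q Z(1) by (auto simp: bij_betw_def)
    moreover have "?q y \<in> A" using q y by (auto simp: bij_betw_def)
    ultimately obtain u where u: "u \<in> ?H" "u \<subseteq> ?q ` Z" "|u| =o natLeq" "f u = ?q y"
      using f[OF dense_hereditary_vimage[OF H inj], of "?q ` Z" "?q y"] by blast
    have uA: "u \<subseteq> A" using u(2) \<open>?q ` Z \<subseteq> A\<close> by auto
    have injq: "inj_on p u" using inj uA inj_on_subset by blast
    have "?q ` p ` u = u"
      using uA by (force simp: the_inv_into_f_f[OF inj] image_image)
    then have "g (p ` u) = y"
      using u(4) y im by (simp add: g_def f_the_inv_into_f[OF inj])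
    moreover have "p ` u \<subseteq> Z"
    proof
      fix b assume "b \<in> p ` u"
      then obtain c where "c \<in> Z" "b = p (?q c)" using u(2) by auto
      then show "b \<in> Z" using Z(1) im by (auto simp: f_the_inv_into_f[OF inj])
    qed
    moreover have "|p ` u| =o natLeq"
      using u(3) injq by (simp add: card_of_ordIso_natLeq_iff finite_image_iff)
    moreover have "p ` u \<in> H"
      using u(1,3) uA by (auto simp: card_of_ordIso_natLeq_iff Int_absorb2)
    ultimately show ?thesis by blast
  qed
  then show thesis by (rule that)
qed

section \<open>Cardinal bounds for finite subsets and finite unions\<close>

text \<open>Adding a point to a set of size \<open>n\<close> gives all sets of size
  \<open>Suc n\<close>, so each size class is bounded by induction; there are countably many
  classes.\<close>

lemma card_of_Fpow_ordLeq:
  assumes inf: "infinite B" and le: "|A| \<le>o |B|"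
  shows "|Fpow A| \<le>o |B|"
proof -
  have "|{s \<in> Fpow A. card s = n}| \<le>o |B|" for n
  proof (induction n)
    case 0
    have "{s \<in> Fpow A. card s = 0} \<subseteq> {{}}" by (auto simp: Fpow_def)
    then have "finite {s \<in> Fpow A. card s = 0}" by (rule finite_subset) simp
    then show ?case using inf
      using finite_ordLess_infinite[OF card_of_Well_order card_of_Well_order, of "{s \<in> Fpow A. card s = 0}" B]
      by (simp add: Field_card_of ordLess_imp_ordLeq)
  next
    case (Suc n)
    let ?N = "{s \<in> Fpow A. card s = n}"
    have "{s \<in> Fpow A. card s = Suc n} \<subseteq> (\<lambda>(a, s). insert a s) ` (A \<times> ?N)"
    proof
      fix s assume s: "s \<in> {s \<in> Fpow A. card s = Suc n}"
      then obtain a s' where "s = insert a s'" "a \<notin> s'" "card s' = n" "finite s'"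
        by (auto simp: card_Suc_eq_finite)
      then show "s \<in> (\<lambda>(a, s). insert a s) ` (A \<times> ?N)"
        using s by (auto simp: Fpow_def intro!: image_eqI[of _ _ "(a, s')"])
    qed
    then have "|{s \<in> Fpow A. card s = Suc n}| \<le>o |A \<times> ?N|" by (rule surj_imp_ordLeq)
    also have "|A \<times> ?N| \<le>o |B|"
      using card_of_Times_ordLeq_infinite_Field[of "|B|" A ?N] inf le Suc.IH
      by (simp add: Field_card_of card_of_card_order_on)
    finally show ?case .
  qed
  moreover have "|UNIV :: nat set| \<le>o |B|" using inf by (simp only: infinite_iff_card_of_nat)
  ultimately have "|\<Union>n. {s \<in> Fpow A. card s = n}| \<le>o |B|"
    by (intro card_of_UNION_ordLeq_infinite[OF inf]) simp_all
  moreover have "(\<Union>n. {s \<in> Fpow A. card s = n}) = Fpow A" by auto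
  ultimately show ?thesis by simp
qed

lemma card_of_finite_UNION_ordLess:
  assumes "finite I" "infinite C" "\<And>i. i \<in> I \<Longrightarrow> |A i| <o |C|"
  shows "|\<Union>i\<in>I. A i| <o |C|"
  using assms(1,3)
proof (induction I)
  case empty
  then show ?case using assms(2) 
    using finite_ordLess_infinite[OF card_of_Well_order card_of_Well_order, of "{}" C] by (simp add: Field_card_of)
next
  case (insert i I)
  then show ?case using card_of_Un_ordLess_infinite[OF assms(2), of "A i" "\<Union> (A ` I)"] by simp
qed

section \<open>Uniform filters and full sets of colours\<close>

lemma bd_subsets_insert:
  assumes "u \<in> bd_subsets r (x \<inter> aboveS r a)" "a \<in> x" "trans r"
  shows "insert a u \<in> bd_subsets r x"
proof -
  obtain b where u: "u \<subseteq> x \<inter> aboveS r a" "|u| =o natLeq" and b: "b \<in> Field r" "u \<subseteq> under r b"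
    using assms(1) by (auto simp: bd_subsets_def)
  have "u \<noteq> {}" using u(2) by (auto simp: card_of_ordIso_natLeq_iff)
  then obtain d where d: "d \<in> u" by blast
  then have "(a, d) \<in> r" "(d, b) \<in> r" using u(1) b(2) by (auto simp: aboveS_def under_def)
  then have "(a, b) \<in> r" using assms(3) by (meson transD)
  then have "insert a u \<subseteq> under r b" using b(2) by (auto simp: under_def)
  moreover have "|insert a u| =o natLeq" using u(2) by (simp add: card_of_ordIso_natLeq_iff)
  ultimately show ?thesis using u(1) b(1) assms(2) by (auto simp: bd_subsets_def)
qed

lemma bd_subsets_Un:
  assumes r: "Well_order r" and u: "u \<in> bd_subsets r x" and v: "v \<in> bd_subsets r x"
  shows "u \<union> v \<in> bd_subsets r x"
proof -
  have T: "trans r" "total_on (Field r) r" "refl_on (Field r) r"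
    using r by (auto simp: order_on_defs)
  obtain a b where a: "a \<in> Field r" "u \<subseteq> under r a" and b: "b \<in> Field r" "v \<subseteq> under r b"
    using u v by (auto simp: bd_subsets_def)
  have "(a, b) \<in> r \<or> (b, a) \<in> r"
    using T a(1) b(1) by (cases "a = b") (auto simp: total_on_def refl_on_def)
  then have "\<exists>c\<in>Field r. u \<union> v \<subseteq> under r c"
  proof
    assume "(a, b) \<in> r"
    then have "under r a \<subseteq> under r b" using T(1) by (simp add: under_incr)
    then show ?thesis using a b by blast
  next
    assume "(b, a) \<in> r"
    then have "under r b \<subseteq> under r a" using T(1) by (simp add: under_incr)
    then show ?thesis using a b by blast
  qed
  then show ?thesis using u v by (simp add: bd_subsets_def card_of_ordIso_natLeq_iff)
qed

text \<open>Supplies boundedness whatever the cofinality: either all countably infinite subsets of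
  the field are bounded, or the initial segments below the points of an unbounded one cover the
  field.\<close>

lemma bounded_countable_cover:
  assumes r: "Well_order r"
  obtains E :: "nat \<Rightarrow> 'a set" where "(\<Union>n. E n) = Field r"
    "\<And>n u. u \<subseteq> E n \<Longrightarrow> |u| =o natLeq \<Longrightarrow> \<exists>a\<in>Field r. u \<subseteq> under r a"
proof (cases "\<forall>u\<subseteq>Field r. |u| =o natLeq \<longrightarrow> (\<exists>a\<in>Field r. u \<subseteq> under r a)")
  case True
  show thesis by (rule that[of "\<lambda>_. Field r"]) (use True in auto)
next
  case False
  then obtain u where u: "u \<subseteq> Field r" "|u| =o natLeq"
    and unb: "\<And>a. a \<in> Field r \<Longrightarrow> \<not> u \<subseteq> under r a" by blast
  have T: "total_on (Field r) r" "refl_on (Field r) r" using r by (auto simp: order_on_defs)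
  have ne: "u \<noteq> {}" and cu: "countable u" using u(2) by (auto simp: card_of_ordIso_natLeq_iff)
  show thesis
  proof (rule that[of "\<lambda>n. under r (from_nat_into u n)"])
    show "(\<Union>n. under r (from_nat_into u n)) = Field r"
    proof
      show "(\<Union>n. under r (from_nat_into u n)) \<subseteq> Field r" using under_Field by fastforce
      show "Field r \<subseteq> (\<Union>n. under r (from_nat_into u n))"
      proof
        fix a assume a: "a \<in> Field r"
        then obtain b where b: "b \<in> u" "(b, a) \<notin> r" using unb[OF a] by (auto simp: under_def)
        then have "(a, b) \<in> r"
          using T a u(1) by (cases "a = b") (auto simp: total_on_def refl_on_def)
        moreover obtain n where "from_nat_into u n = b"
          using from_nat_into_surj[OF cu b(1)] by blast
        ultimately show "a \<in> (\<Union>n. under r (from_nat_into u n))" by (auto simp: under_def)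
      qed
    qed
    fix n v assume "v \<subseteq> under r (from_nat_into u n)"
    then show "\<exists>a\<in>Field r. v \<subseteq> under r a" using from_nat_into[OF ne, of n] u(1) by auto
  qed
qed

locale uniform_family =
  fixes r :: "'a rel" and F :: "'a set set"
  assumes card_order: "Card_order r"
    and uncountable: "natLeq <o r"
    and subset_Field: "x \<in> F \<Longrightarrow> x \<subseteq> Field r"
    and Field_in: "Field r \<in> F"
    and Int_in: "x \<in> F \<Longrightarrow> y \<in> F \<Longrightarrow> x \<inter> y \<in> F"
    and aboveS_in: "a \<in> Field r \<Longrightarrow> aboveS r a \<in> F"
    and uniform: "x \<in> F \<Longrightarrow> |x| =o r"
begin

text \<open>Fullness of \<open>Field r\<close> is what refutes the colouring clause of
  \<open>Magidor_filter\<close>. The colour type is free, so that indices of colourings can serve as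
  colours too.\<close>

definition full :: "'b set \<Rightarrow> bool" where
  "full K \<longleftrightarrow> (\<exists>c :: 'a set \<Rightarrow> 'b. \<forall>x\<in>F. K \<subseteq> c ` bd_subsets r x)"

lemma well_order: "Well_order r"
  using card_order by (simp add: card_order_on_def)

lemma infinite_Field: "infinite (Field r)"
proof -
  have "natLeq \<le>o |Field r|"
    using uncountable card_of_Field_ordIso[OF card_order]
    by (meson ordLess_imp_ordLeq ordIso_symmetric ordLess_ordIso_trans)
  then show ?thesis using infinite_iff_natLeq_ordLeq by blast
qed

lemma not_subset_smaller:
  assumes "x \<in> F" "|B| <o r"
  shows "\<not> x \<subseteq> B"
proof
  assume "x \<subseteq> B"
  then have "|x| <o r" using card_of_mono1 assms(2) ordLeq_ordLess_trans by blast
  then show False using uniform[OF assms(1)] not_ordLess_ordIso by blast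
qed

lemma nonempty: "x \<in> F \<Longrightarrow> x \<noteq> {}"
  using card_of_ordIso_finite[of x "Field r"] uniform[of x] infinite_Field
    ordIso_transitive[OF _ ordIso_symmetric[OF card_of_Field_ordIso[OF card_order]]] by auto

lemma full_ordLeq:
  assumes "full K" "|L| \<le>o |K|"
  shows "full L"
proof (cases "L = {}")
  case False
  then obtain g where g: "g ` K = L" using assms(2) card_of_ordLeq2[of L K] by auto
  obtain c where c: "\<And>x. x \<in> F \<Longrightarrow> K \<subseteq> c ` bd_subsets r x"
    using assms(1) unfolding full_def by blast
  have "L \<subseteq> (g \<circ> c) ` bd_subsets r x" if "x \<in> F" for x
    using image_mono[OF c[OF that], of g] g by (simp add: image_comp)
  then show ?thesis unfolding full_def by blast
qed (simp add: full_def)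

text \<open>The least point of \<open>u\<close> selects the colouring that is applied to the other points.\<close>

lemma full_by_least:
  assumes "\<And>x k. x \<in> F \<Longrightarrow> k \<in> K \<Longrightarrow> \<exists>a\<in>x. \<forall>y\<in>F. k \<in> c a ` bd_subsets r y"
  shows "full K"
proof -
  have wo: "wo_rel r" using well_order by (simp add: wo_rel_def)
  define d where "d u = c (wo_rel.minim r u) (u - {wo_rel.minim r u})" for u
  have "k \<in> d ` bd_subsets r x" if x: "x \<in> F" and k: "k \<in> K" for x k
  proof -
    obtain a where a: "a \<in> x" "\<And>y. y \<in> F \<Longrightarrow> k \<in> c a ` bd_subsets r y"
      using assms[OF x k] by blast
    have aF: "a \<in> Field r" using a(1) subset_Field[OF x] by blast
    \<comment> \<open>Choosing \<open>u\<close> above \<open>a\<close> makes \<open>a\<close> the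
      least point of \<open>insert a u\<close>.\<close>
    have "x \<inter> aboveS r a \<in> F" using Int_in[OF x aboveS_in[OF aF]] .
    then obtain u where u: "u \<in> bd_subsets r (x \<inter> aboveS r a)" "c a u = k" using a(2) by blast
    have uab: "u \<subseteq> aboveS r a" using u(1) by (auto simp: bd_subsets_def)
    have "wo_rel.minim r (insert a u) = a"
    proof (rule wo_rel.equals_minim[OF wo, symmetric])
      show "insert a u \<subseteq> Field r"
        using uab aF by (auto simp: aboveS_def intro: FieldI2)
      show "(a, b) \<in> r" if "b \<in> insert a u" for b
        using that uab aF wo_rel.REFL[OF wo] by (auto simp: aboveS_def refl_on_def)
    qed simp
    moreover have "insert a u - {a} = u" using uab by (auto simp: aboveS_def)
    ultimately have "d (insert a u) = k" using u(2) by (simp add: d_def)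
    then show ?thesis using bd_subsets_insert[OF u(1) a(1) wo_rel.TRANS[OF wo]] by blast
  qed
  then show ?thesis unfolding full_def by blast
qed

text \<open>Each member is uncountable, so it meets some piece of the countable cover in an infinite
  set; there \<open>t\<close> takes all values on bounded sets.\<close>

lemma full_nat: "full (UNIV :: nat set)"
proof -
  obtain rep :: "'a set \<Rightarrow> 'a set" and t :: "'a set \<Rightarrow> nat" where
    t: "\<And>z w k. infinite z \<Longrightarrow> finite w \<Longrightarrow>
      \<exists>u\<subseteq>z - w. finite (z - u) \<and> rep u = rep z \<and> t u = k"
    by (rule mod_finite_colouring) blast
  obtain E :: "nat \<Rightarrow> 'a set" where E: "(\<Union>n. E n) = Field r"
    "\<And>n u. u \<subseteq> E n \<Longrightarrow> |u| =o natLeq \<Longrightarrow> \<exists>a\<in>Field r. u \<subseteq> under r a"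
    using bounded_countable_cover[OF well_order] by blast
  have "k \<in> t ` bd_subsets r x" if x: "x \<in> F" for x k
  proof -
    have "\<exists>n. infinite (x \<inter> E n)"
    proof (rule ccontr)
      assume "\<not> ?thesis"
      then have "countable (\<Union>n. x \<inter> E n)"
        by (intro countable_UN) (auto intro: countable_finite)
      moreover have "(\<Union>n. x \<inter> E n) = x" using E(1) subset_Field[OF x] by blast
      ultimately have "countable x" by simp
      then have "|x| \<le>o natLeq"
        by (metis card_of_ordIso_natLeq_iff finite_iff_ordLess_natLeq ordIso_imp_ordLeq ordLess_imp_ordLeq)
      then have "r \<le>o natLeq" using uniform[OF x] ordIso_symmetric ordIso_ordLeq_trans by blast
      then show False using uncountable not_ordLess_ordLeq by blast
    qed
    then obtain n where "infinite (x \<inter> E n)" by blast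
    then obtain z where z: "infinite z" "countable z" "z \<subseteq> x \<inter> E n"
      using infinite_countable_subset'[of "x \<inter> E n"] by blast
    obtain u where u: "u \<subseteq> z" "finite (z - u)" "t u = k"
      using t[OF z(1), of "{}" k] by auto
    have "u \<union> (z - u) = z" using u(1) by blast
    then have "infinite u" using u(2) z(1) finite_UnI[of u "z - u"] by auto
    moreover have "countable u" using countable_subset[OF u(1) z(2)] .
    ultimately have "|u| =o natLeq" by (simp add: card_of_ordIso_natLeq_iff)
    moreover have "u \<subseteq> E n" "u \<subseteq> x" using u(1) z(3) by auto
    ultimately have "u \<in> bd_subsets r x" using E(2) by (auto simp: bd_subsets_def)
    then show ?thesis using u(3) by blast
  qed
  then show ?thesis unfolding full_def by blast
qed

text \<open>
  For \<open>v\<close> of type \<open>\<omega>\<close> below \<open>w\<close>, both sets are recovered from \<open>v \<union> w\<close>, so that \<open>w\<close> can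
  select the colouring that is applied to \<open>v\<close>.
\<close>

lemma ex_reducing_member:
  fixes K :: "'a set" and Y :: "'s \<Rightarrow> 'a set"
  assumes K: "\<not> full K" "infinite K" and S: "full S"
    and Y: "\<And>s. s \<in> S \<Longrightarrow> Y s \<subseteq> Field r" "\<And>s. s \<in> S \<Longrightarrow> |K| \<le>o |Y s|"
      "\<And>s u. s \<in> S \<Longrightarrow> u \<subseteq> Y s \<Longrightarrow> |u| =o natLeq \<Longrightarrow> \<exists>a\<in>Field r. u \<subseteq> under r a"
  shows "\<exists>D\<in>F. \<forall>s\<in>S. |D \<inter> Y s| <o |Y s|"
proof (rule ccontr)
  assume neg: "\<not> ?thesis"
  have large: "\<exists>s\<in>S. |x \<inter> Y s| =o |Y s|" if "x \<in> F" for x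
  proof -
    obtain s where s: "s \<in> S" "\<not> |x \<inter> Y s| <o |Y s|" using neg \<open>x \<in> F\<close> by blast
    have "|x \<inter> Y s| \<le>o |Y s|" by (rule card_of_mono1) simp
    then show ?thesis using s ordLeq_iff_ordLess_or_ordIso by blast
  qed
  obtain cS where cS: "\<And>x. x \<in> F \<Longrightarrow> S \<subseteq> cS ` bd_subsets r x"
    using S unfolding full_def by blast
  let ?H = "{u. omega_part r u = u}"
  \<comment> \<open>Such an \<open>h\<close> is an \<omega>-Jonsson function on \<open>Y s\<close>
    followed by a surjection of \<open>Y s\<close> onto \<open>K\<close>.\<close>
  define onto where "onto s h \<longleftrightarrow> (\<forall>Z\<subseteq>Y s. |Z| =o |Y s| \<longrightarrow>
    (\<forall>k\<in>K. \<exists>u\<in>?H. u \<subseteq> Z \<and> |u| =o natLeq \<and> h u = k))" for s and h :: "'a set \<Rightarrow> 'a"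
  have "\<exists>h. onto s h" if s: "s \<in> S" for s
  proof -
    have inf: "infinite (Y s)" using card_of_ordLeq_infinite[OF Y(2)[OF s] K(2)] .
    obtain g :: "'a set \<Rightarrow> 'a" where g: "\<And>Z y. Z \<subseteq> Y s \<Longrightarrow> |Z| =o |Y s| \<Longrightarrow> y \<in> Y s \<Longrightarrow>
        \<exists>u\<in>?H. u \<subseteq> Z \<and> |u| =o natLeq \<and> g u = y"
      by (rule omega_Jonsson[OF inf dense_hereditary_omega_part[OF well_order]]) blast
    have "K \<noteq> {}" using K(2) by auto
    then obtain p where p: "p ` Y s = K"
      using card_of_ordLeq2[of K "Y s"] Y(2)[OF s] by auto
    have "\<exists>u\<in>?H. u \<subseteq> Z \<and> |u| =o natLeq \<and> (p \<circ> g) u = k"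
      if Z: "Z \<subseteq> Y s" "|Z| =o |Y s|" and k: "k \<in> K" for Z k
    proof -
      obtain y where y: "y \<in> Y s" "p y = k" using k p by auto
      obtain u where "u \<in> ?H" "u \<subseteq> Z" "|u| =o natLeq" "g u = y"
        using g[OF Z y(1)] by blast
      then show ?thesis using y(2) by auto
    qed
    then have "onto s (p \<circ> g)" by (simp add: onto_def)
    then show ?thesis by blast
  qed
  then obtain h where h: "\<And>s. s \<in> S \<Longrightarrow> onto s (h s)" by metis
  \<comment> \<open>The index \<open>s\<close> with \<open>x \<inter> Y s\<close> large depends on
    \<open>x\<close>; the part of \<open>u\<close> beyond its \<omega>-part encodes it through
    \<open>cS\<close>.\<close>
  define c where "c u = h (cS (u - omega_part r u)) (omega_part r u)" for u
  have "k \<in> c ` bd_subsets r x" if x: "x \<in> F" and k: "k \<in> K" for x k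
  proof -
    obtain s where s: "s \<in> S" "|x \<inter> Y s| =o |Y s|" using large[OF x] by blast
    obtain v where v: "v \<in> ?H" "v \<subseteq> x \<inter> Y s" "|v| =o natLeq" "h s v = k"
      using h[OF s(1)] s(2) k unfolding onto_def by (meson inf_le2)
    have "v \<subseteq> Y s" using v(2) by blast
    then obtain a where a: "a \<in> Field r" "v \<subseteq> under r a" using Y(3)[OF s(1) _ v(3)] by blast
    have "x \<inter> aboveS r a \<in> F" using Int_in[OF x aboveS_in[OF a(1)]] .
    then obtain w where w: "w \<in> bd_subsets r (x \<inter> aboveS r a)" "cS w = s"
      using cS s(1) by blast
    have T: "antisym r" "trans r" using well_order by (auto simp: order_on_defs)
    have below: "e \<in> aboveS r d" if "d \<in> v" "e \<in> w" for d e
    proof -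
      have de: "(d, a) \<in> r" "(a, e) \<in> r" "e \<noteq> a"
        using that a(2) w(1) by (auto simp: under_def aboveS_def bd_subsets_def)
      then have "(d, e) \<in> r" "d \<noteq> e" using T by (meson transD, meson antisymD)
      then show ?thesis by (simp add: aboveS_def)
    qed
    have om: "omega_part r (v \<union> w) = v"
      using omega_part_Un[OF T(1) _ _ below] v(1,3) by (simp add: card_of_ordIso_natLeq_iff)
    have "v \<inter> w = {}" using below by (auto simp: aboveS_def)
    then have "(v \<union> w) - v = w" by blast
    then have "c (v \<union> w) = k" using om w(2) v(4) by (simp add: c_def)
    moreover have "v \<in> bd_subsets r x" using v a by (auto simp: bd_subsets_def)
    moreover have "w \<in> bd_subsets r x" using w(1) by (auto simp: bd_subsets_def)
    ultimately show ?thesis using bd_subsets_Un[OF well_order] by blast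
  qed
  then have "full K" unfolding full_def by blast
  then show False using K(1) by simp
qed

section \<open>A least set of colours that is not full\<close>

text \<open>If \<open>K\<close> had size at least \<open>r\<close>, minimality would make every
  \<open>underS r a\<close> full; since each member of \<open>F\<close> has points above any
  \<open>k\<close>, selection by the least point would then make \<open>Field r\<close> full.
  Countable sets are full by \<open>full_nat\<close>.\<close>

lemma least_not_full:
  assumes "\<not> full (Field r)"
  obtains K :: "'a set" where "\<not> full K" "|K| <o r" "natLeq <o |K|"
    "\<And>L :: 'a set. |L| <o |K| \<Longrightarrow> full L"
proof -
  let ?R = "{|K| |K :: 'a set. \<not> full K}"
  have "\<exists>q\<in>?R. \<forall>q'\<in>?R. q \<le>o q'"
    by (rule exists_minim_Card_order) (use assms in \<open>auto simp: card_of_card_order_on Field_card_of\<close>)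
  then obtain K :: "'a set" where K: "\<not> full K" and min: "\<And>L :: 'a set. \<not> full L \<Longrightarrow> |K| \<le>o |L|"
    by blast
  have less: "full L" if "|L| <o |K|" for L :: "'a set"
    using min[of L] that not_ordLess_ordLeq by blast
  have "\<not> r \<le>o |K|"
  proof
    assume le: "r \<le>o |K|"
    have "full (underS r a)" if "a \<in> Field r" for a
      using less ordLess_ordLeq_trans[OF card_of_underS[OF card_order that] le] by blast
    then have "\<forall>a. \<exists>c. a \<in> Field r \<longrightarrow> (\<forall>y\<in>F. underS r a \<subseteq> c ` bd_subsets r y)"
      unfolding full_def by blast
    then obtain c where c: "\<And>a y. a \<in> Field r \<Longrightarrow> y \<in> F \<Longrightarrow> underS r a \<subseteq> c a ` bd_subsets r y"
      by metis
    have "full (Field r)"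
    proof (rule full_by_least)
      fix x k assume x: "x \<in> F" and k: "k \<in> Field r"
      obtain a where a: "a \<in> x" "a \<in> aboveS r k"
        using nonempty[OF Int_in[OF x aboveS_in[OF k]]] by blast
      then have "k \<in> underS r a" "a \<in> Field r"
        using subset_Field[OF x] by (auto simp: aboveS_def underS_def)
      then show "\<exists>a\<in>x. \<forall>y\<in>F. k \<in> c a ` bd_subsets r y" using a(1) c by blast
    qed
    then show False using assms by simp
  qed
  then have small: "|K| <o r" using not_ordLeq_iff_ordLess[OF card_of_Well_order well_order] by blast
  have "\<not> |K| \<le>o natLeq"
  proof
    assume "|K| \<le>o natLeq"
    then have "|K| \<le>o |UNIV :: nat set|"
      using card_of_nat ordIso_symmetric ordLeq_ordIso_trans by blast
    then show False using full_ordLeq[OF full_nat] K by blast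
  qed
  then have unc: "natLeq <o |K|"
    using not_ordLeq_iff_ordLess[OF natLeq_Well_order card_of_Well_order] by blast
  show thesis
  proof (rule that[OF K small unc])
    fix L :: "'a set" assume "|L| <o |K|"
    then show "full L" by (rule less)
  qed
qed

text \<open>
  The members \<open>D i\<close> shrink every large finite intersection of their predecessors below points of
  a countable cover.  As cardinals cannot decrease infinitely often, almost no point lies in
  infinitely many of them.
\<close>

lemma ex_point_finite_sequence:
  fixes K :: "'a set"
  assumes K: "\<not> full K" "natLeq <o |K|" and less: "\<And>L :: 'a set. |L| <o |K| \<Longrightarrow> full L"
  obtains D :: "'a \<Rightarrow> 'a set" where "\<And>i. i \<in> K \<Longrightarrow> D i \<in> F"
    "|{a \<in> Field r. infinite {i \<in> K. a \<in> D i}}| \<le>o |K|"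
proof -
  let ?k = "|K|"
  have wo: "Well_order ?k" by (rule card_of_Well_order)
  have wf: "wf (?k - Id)" using wo by (simp add: well_order_on_def)
  have infK: "infinite K"
    using K(2) ordLess_imp_ordLeq infinite_iff_natLeq_ordLeq by blast
  have natK: "|UNIV :: nat set| <o |K|" using K(2) card_of_nat ordIso_ordLess_trans by blast
  obtain E :: "nat \<Rightarrow> 'a set" where E: "(\<Union>n. E n) = Field r" and
    bd: "\<And>n u. u \<subseteq> E n \<Longrightarrow> |u| =o natLeq \<Longrightarrow> \<exists>a\<in>Field r. u \<subseteq> under r a"
    using bounded_countable_cover[OF well_order] by blast
  \<comment> \<open>The factor \<open>E (snd p)\<close> makes countably infinite subsets bounded, as
    \<open>ex_reducing_member\<close> demands. In \<open>P\<close>, the guard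
    \<open>i \<in> K\<close> is there because the recursion ranges over the whole type.\<close>
  define Y where "Y f p = E (snd p) \<inter> (\<Inter>j\<in>fst p. f j)"
    for f :: "'a \<Rightarrow> 'a set" and p :: "'a set \<times> nat"
  define P where "P f i D \<longleftrightarrow> i \<in> K \<longrightarrow> D \<in> F \<and>
    (\<forall>p\<in>Fpow (underS ?k i) \<times> UNIV. |K| \<le>o |Y f p| \<longrightarrow> |D \<inter> Y f p| <o |Y f p| )"
    for f :: "'a \<Rightarrow> 'a set" and i D
  have "\<exists>D. \<forall>i. P D i (D i)"
  proof (rule dependent_wf_choice[OF wf])
    fix f g :: "'a \<Rightarrow> 'a set" and i D
    assume eq: "\<And>z. (z, i) \<in> ?k - Id \<Longrightarrow> f z = g z"
    have "Y f p = Y g p" if "p \<in> Fpow (underS ?k i) \<times> UNIV" for p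
    proof -
      have "f j = g j" if "j \<in> fst p" for j
        by (rule eq) (use that \<open>p \<in> _\<close> in \<open>auto simp: Fpow_def underS_def\<close>)
      then show ?thesis by (simp add: Y_def)
    qed
    then show "P f i D = P g i D" by (simp add: P_def)
  next
    fix i and f :: "'a \<Rightarrow> 'a set"
    show "\<exists>D. P f i D"
    proof (cases "i \<in> K")
      case True
      define S where "S = {p \<in> Fpow (underS ?k i) \<times> (UNIV :: nat set). |K| \<le>o |Y f p|}"
      \<comment> \<open>Adding the naturals gives an infinite bound for the number of pairs even
        when \<open>underS ?k i\<close> is finite; it stays below the uncountable
        \<open>|K|\<close>.\<close>
      let ?U = "underS ?k i <+> (UNIV :: nat set)"
      have "|underS ?k i| <o |K|"
        using card_of_underS[OF card_of_Card_order, of i K] True by (simp add: Field_card_of)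
      then have U: "|?U| <o |K|" by (rule card_of_Plus_ordLess_infinite[OF infK _ natK])
      have "|UNIV :: nat set| \<le>o |?U|" by (rule card_of_Plus2)
      moreover have "infinite ?U" by simp
      moreover have "|Fpow (underS ?k i)| \<le>o |?U|"
        by (rule card_of_Fpow_ordLeq[OF \<open>infinite ?U\<close> card_of_Plus1])
      ultimately have "|Fpow (underS ?k i) \<times> (UNIV :: nat set)| \<le>o |?U|"
        using card_of_Times_ordLeq_infinite_Field[of "|?U|"]
        by (simp add: Field_card_of card_of_card_order_on)
      moreover have "|S| \<le>o |Fpow (underS ?k i) \<times> (UNIV :: nat set)|"
        by (rule card_of_mono1) (auto simp: S_def)
      ultimately have "|S| <o |K|" using U ordLeq_transitive ordLeq_ordLess_trans by blast
      \<comment> \<open>Minimality of \<open>K\<close> concerns sets of type \<open>'a set\<close>,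
        so \<open>S\<close> is replaced by an equinumerous subset of \<open>K\<close>.\<close>
      then obtain L where L: "L \<subset> K" "|S| =o |L|" "|L| <o |K|"
        using internalize_card_of_ordLess[of S "|K|"] by (auto simp: Field_card_of)
      then have fS: "full S" using full_ordLeq[OF less[OF L(3)]] ordIso_imp_ordLeq by blast
      have "\<exists>D\<in>F. \<forall>p\<in>S. |D \<inter> Y f p| <o |Y f p|"
      proof (rule ex_reducing_member[OF K(1) infK fS])
        fix p assume p: "p \<in> S"
        show "|K| \<le>o |Y f p|" using p by (simp add: S_def)
        have "Y f p \<subseteq> E (snd p)" by (auto simp: Y_def)
        then show "Y f p \<subseteq> Field r" using E by blast
        show "\<exists>a\<in>Field r. u \<subseteq> under r a" if "u \<subseteq> Y f p" "|u| =o natLeq" for u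
          using bd[of u "snd p"] that \<open>Y f p \<subseteq> E (snd p)\<close> by blast
      qed
      then show ?thesis by (auto simp: P_def S_def)
    qed (simp add: P_def)
  qed
  then obtain D where D: "\<And>i. P D i (D i)" by blast
  let ?I = "{p \<in> Fpow K \<times> (UNIV :: nat set). |Y D p| <o |K|}"
  have "{a \<in> Field r. infinite {i \<in> K. a \<in> D i}} \<subseteq> (\<Union>p\<in>?I. Y D p)"
  proof
    fix a assume "a \<in> {a \<in> Field r. infinite {i \<in> K. a \<in> D i}}"
    then have aF: "a \<in> Field r" and infQ: "infinite {i \<in> K. a \<in> D i}" by auto
    obtain n where n: "a \<in> E n" using E aF by blast
    \<comment> \<open>Order type \<omega> ensures that every finite subset of \<open>Q\<close> has a
      later index in \<open>Q\<close>.\<close>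
    define Q where "Q = omega_part ?k {i \<in> K. a \<in> D i}"
    have Q: "infinite Q" "omega_part ?k Q = Q" "Q \<subseteq> {i \<in> K. a \<in> D i}"
      by (simp_all add: Q_def infinite_omega_part[OF wo infQ] omega_part_idem omega_part_subset)
    let ?R = "{|Y D (s, n)| |s. s \<in> Fpow Q}"
    have "\<exists>q\<in>?R. \<forall>q'\<in>?R. q \<le>o q'"
      by (rule exists_minim_Card_order)
        (auto simp: card_of_card_order_on Field_card_of intro: empty_in_Fpow)
    then obtain s where s: "s \<in> Fpow Q"
      and min: "\<And>s'. s' \<in> Fpow Q \<Longrightarrow> |Y D (s, n)| \<le>o |Y D (s', n)|" by blast
    have sQ: "s \<subseteq> Q" "finite s" using s by (auto simp: Fpow_def)
    have "finite (underS ?k j \<inter> Q)" if "j \<in> s" for j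
      using Q(2) sQ that by (auto simp: omega_part_def)
    then have "finite (s \<union> (\<Union>j\<in>s. underS ?k j \<inter> Q))"
      using sQ(2) by (intro finite_UnI finite_UN_I)
    then obtain i where i: "i \<in> Q" "i \<notin> s \<union> (\<Union>j\<in>s. underS ?k j \<inter> Q)"
      using Q(1) finite_subset[of Q] by blast
    have iK: "i \<in> K" using i(1) Q(3) by blast
    have "s \<subseteq> underS ?k i"
    proof
      fix j assume j: "j \<in> s"
      have "j \<in> K" using j sQ(1) Q(3) by blast
      moreover have "j \<noteq> i" "(i, j) \<notin> ?k" using i j by (auto simp: underS_def)
      moreover have "total_on K ?k" using card_of_well_order_on[of K] by (simp add: order_on_defs)
      ultimately show "j \<in> underS ?k i" using iK by (auto simp: total_on_def underS_def)
    qed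
    then have mem: "(s, n) \<in> Fpow (underS ?k i) \<times> UNIV" using sQ(2) by (simp add: Fpow_def)
    have "Y D (insert i s, n) = D i \<inter> Y D (s, n)" by (auto simp: Y_def)
    moreover have "insert i s \<in> Fpow Q" using i(1) sQ by (simp add: Fpow_def)
    \<comment> \<open>By minimality \<open>D i\<close> does not shrink \<open>Y D (s, n)\<close>, so
      the recursion condition can only have failed to apply: the set is smaller than
      \<open>K\<close>.\<close>
    ultimately have "|Y D (s, n)| \<le>o |D i \<inter> Y D (s, n)|" using min[of "insert i s"] by simp
    then have "\<not> |D i \<inter> Y D (s, n)| <o |Y D (s, n)|" using not_ordLess_ordLeq by blast
    then have "\<not> |K| \<le>o |Y D (s, n)|" using D[of i] iK mem unfolding P_def by blast
    then have "|Y D (s, n)| <o |K|"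
      using not_ordLeq_iff_ordLess[OF card_of_Well_order card_of_Well_order] by blast
    moreover have "s \<in> Fpow K" using sQ Q(3) by (auto simp: Fpow_def)
    moreover have "a \<in> Y D (s, n)" using n sQ(1) Q(3) by (auto simp: Y_def)
    ultimately show "a \<in> (\<Union>p\<in>?I. Y D p)" by auto
  qed
  then have "|{a \<in> Field r. infinite {i \<in> K. a \<in> D i}}| \<le>o |\<Union>p\<in>?I. Y D p|"
    by (rule card_of_mono1)
  moreover have "|\<Union>p\<in>?I. Y D p| \<le>o |K|"
  proof (rule card_of_UNION_ordLeq_infinite[OF infK])
    have "|Fpow K| \<le>o |K|"
      by (rule card_of_Fpow_ordLeq[OF infK ordIso_imp_ordLeq[OF card_of_refl]])
    then have "|Fpow K \<times> (UNIV :: nat set)| \<le>o |K|"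
      using card_of_Times_ordLeq_infinite_Field[of "|K|"] infK ordLess_imp_ordLeq[OF natK]
      by (simp add: Field_card_of card_of_card_order_on)
    moreover have "|?I| \<le>o |Fpow K \<times> (UNIV :: nat set)|" by (rule card_of_mono1) auto
    ultimately show "|?I| \<le>o |K|" using ordLeq_transitive by blast
    show "\<forall>p\<in>?I. |Y D p| \<le>o |K|" using ordLess_imp_ordLeq by blast
  qed
  ultimately have "|{a \<in> Field r. infinite {i \<in> K. a \<in> D i}}| \<le>o |K|"
    using ordLeq_transitive by blast
  moreover have "D i \<in> F" if "i \<in> K" for i using D[of i] that by (simp add: P_def)
  ultimately show thesis using that by blast
qed

lemma full_Field: "full (Field r)"
proof (rule ccontr)
  assume "\<not> full (Field r)"
  then obtain K :: "'a set" where K: "\<not> full K" "|K| <o r" "natLeq <o |K|"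
    and less: "\<And>L :: 'a set. |L| <o |K| \<Longrightarrow> full L"
    using least_not_full by blast
  let ?k = "|K|"
  have infK: "infinite K"
    using K(3) ordLess_imp_ordLeq infinite_iff_natLeq_ordLeq by blast
  obtain D :: "'a \<Rightarrow> 'a set" where D: "\<And>i. i \<in> K \<Longrightarrow> D i \<in> F"
    and Bad: "|{a \<in> Field r. infinite {i \<in> K. a \<in> D i}}| \<le>o |K|"
    using ex_point_finite_sequence[OF K(1,3) less] by blast
  define Q where "Q a = {i \<in> K. a \<in> D i}" for a
  \<comment> \<open>For finite \<open>Q a\<close> this is a finite union of proper initial segments
    of \<open>|K|\<close>, hence smaller than \<open>K\<close> and full.\<close>
  define W where "W a = (\<Union>i\<in>Q a. underS ?k i)" for a
  have "full (W a)" if "finite (Q a)" for a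
  proof -
    have "|W a| <o |K|"
      unfolding W_def
    proof (rule card_of_finite_UNION_ordLess[OF that infK])
      fix i assume "i \<in> Q a"
      then show "|underS ?k i| <o |K|"
        using card_of_underS[OF card_of_Card_order, of i K] by (simp add: Q_def Field_card_of)
    qed
    then show ?thesis by (rule less)
  qed
  then have "\<forall>a. \<exists>c. finite (Q a) \<longrightarrow> (\<forall>y\<in>F. W a \<subseteq> c ` bd_subsets r y)"
    unfolding full_def by blast
  then obtain c where c: "\<And>a y. finite (Q a) \<Longrightarrow> y \<in> F \<Longrightarrow> W a \<subseteq> c a ` bd_subsets r y"
    by metis
  have "full K"
  proof (rule full_by_least)
    fix x k assume x: "x \<in> F" and k: "k \<in> K"
    obtain i where i: "i \<in> K" "k \<noteq> i" "(k, i) \<in> ?k"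
      using infinite_Card_order_limit[OF card_of_Card_order, of K k] infK k
      by (auto simp: Field_card_of)
    \<comment> \<open>The intersection has size \<open>r\<close>, whereas at most \<open>|K|\<close>
      points lie in infinitely many \<open>D i\<close>.\<close>
    have "\<not> x \<inter> D i \<subseteq> {a \<in> Field r. infinite {i \<in> K. a \<in> D i}}"
      by (rule not_subset_smaller[OF Int_in[OF x D[OF i(1)]] ordLeq_ordLess_trans[OF Bad K(2)]])
    then obtain a where a: "a \<in> x" "a \<in> D i" "finite (Q a)"
      using subset_Field[OF x] by (auto simp: Q_def)
    have "k \<in> W a" using a(2) i by (auto simp: W_def Q_def underS_def)
    then show "\<exists>a\<in>x. \<forall>y\<in>F. k \<in> c a ` bd_subsets r y" using a(1) c[OF a(3)] by blast
  qed
  then show False using K(1) by simp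
qed

end

section \<open>Magidor filters\<close>

lemma uniform_family_filter_sets:
  assumes r: "Card_order r" "natLeq <o r" and F: "filter_over r F" "uniform_filter r F"
    and above: "\<And>a. a \<in> Field r \<Longrightarrow> above r a \<in> filter_sets r F"
  shows "uniform_family r (filter_sets r F)"
proof
  show "Field r \<in> filter_sets r F"
    using F(1) by (simp add: filter_over_def filter_sets_def le_principal)
  show "x \<inter> y \<in> filter_sets r F" if "x \<in> filter_sets r F" "y \<in> filter_sets r F" for x y
    using that by (auto simp: filter_sets_def eventually_conj)
  show "|x| =o r" if "x \<in> filter_sets r F" for x
    using F(2) that by (simp add: uniform_filter_def)
  show "aboveS r a \<in> filter_sets r F" if a: "a \<in> Field r" for a
  proof -
    have "natLeq \<le>o |Field r|"
      using r card_of_Field_ordIso[OF r(1)]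
      by (meson ordLess_imp_ordLeq ordIso_symmetric ordLess_ordIso_trans)
    then have "infinite (Field r)" using infinite_iff_natLeq_ordLeq by blast
    \<comment> \<open>An infinite cardinal is a limit, so the strict end segment at \<open>a\<close>
      contains a closed one at some later \<open>b\<close>.\<close>
    then obtain b where b: "b \<in> Field r" "a \<noteq> b" "(a, b) \<in> r"
      using infinite_Card_order_limit[OF r(1) _ a] by blast
    have T: "antisym r" "trans r" using r(1) by (auto simp: card_order_on_def order_on_defs)
    have "above r b \<subseteq> aboveS r a"
      using b T by (auto simp: above_def aboveS_def dest: transD antisymD)
    moreover have "aboveS r a \<subseteq> Field r" by (auto simp: aboveS_def intro: FieldI2)
    moreover have "\<forall>\<^sub>F c in F. c \<in> above r b" using above[OF b(1)] by (simp add: filter_sets_def)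
    ultimately show ?thesis
      by (auto simp: filter_sets_def elim!: eventually_mono)
  qed
qed (use r in \<open>auto simp: filter_sets_def\<close>)

theorem theorem3p4:
  fixes r :: "'a rel"
  assumes "Card_order r" and "natLeq <o r"
  shows "\<not> (\<exists>F. Magidor_filter r F)"
proof
  assume "\<exists>F. Magidor_filter r F"
  then obtain F where F: "filter_over r F" "uniform_filter r F"
    "\<And>a. a \<in> Field r \<Longrightarrow> above r a \<in> filter_sets r F"
    and M: "\<And>c. c \<in> bd_subsets r (Field r) \<rightarrow> Field r \<Longrightarrow>
      \<exists>x\<in>filter_sets r F. c ` bd_subsets r x \<noteq> Field r"
    unfolding Magidor_filter_def by blast
  interpret uniform_family r "filter_sets r F"
    by (rule uniform_family_filter_sets[OF assms F])
  obtain c :: "'a set \<Rightarrow> 'a" where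
    c: "\<And>x. x \<in> filter_sets r F \<Longrightarrow> Field r \<subseteq> c ` bd_subsets r x"
    using full_Field unfolding full_def by blast
  have "Field r \<noteq> {}" using infinite_Field by auto
  then obtain b where b: "b \<in> Field r" by blast
  \<comment> \<open>The default \<open>b\<close> forces all values into \<open>Field r\<close>
    without losing any value that \<open>c\<close> takes there.\<close>
  define d where "d u = (if c u \<in> Field r then c u else b)" for u
  have "d \<in> bd_subsets r (Field r) \<rightarrow> Field r" using b by (simp add: d_def)
  then obtain x where x: "x \<in> filter_sets r F" "d ` bd_subsets r x \<noteq> Field r" using M by blast
  have "d ` bd_subsets r x \<subseteq> Field r" using b by (auto simp: d_def)
  moreover have "Field r \<subseteq> d ` bd_subsets r x"
  proof
    fix a assume a: "a \<in> Field r"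
    then obtain u where "u \<in> bd_subsets r x" "c u = a" using c[OF x(1)] by blast
    then show "a \<in> d ` bd_subsets r x" using a by (auto simp: d_def)
  qed
  ultimately show False using x(2) by blast
qed

end
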